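(* Let $n\ge 2$. An expansion is commutative: for every $n$-tuple $\mathcal{S}$ of polynomials in $\mathbb{R}[x_1,\dots,x_n]$ and all $1\le i,j\le n$, $$T_{[x_i]\otimes[x_j]}(\mathcal{S})=T_{[x_j]\otimes[x_i]}(\mathcal{S}).$$
   Context: Tuples are $n$-tuples $\mathcal{S}=(f_1,\dots,f_n)$ of polynomials $f_k\in\mathbb{R}[x_1,\dots,x_n]$, with $n\ge 2$. The expansion in the direction $x_i$ is $T_{[x_i]}:=(\gamma^{-1}\circ\beta\circ\gamma\circ\nabla)_{[x_i]}$, where $\nabla_{[x_i]}(\mathcal{S})=(\partial f_1/\partial x_i,\dots,\partial f_n/\partial x_i)$, $\gamma$ turns a tuple into the corresponding column vector, and $\beta$ multiplies a column vector by the $n\times n$ matrix with $0$ on the diagonal and $1$ elsewhere. Thus the $r$-th entry of $T_{[x_i]}(\mathcal{S})$ is $\sum_{t\ne r}\partial f_t/\partial x_i$. The expansion in the mixed direction $[x_i]\otimes[x_j]$ is $T_{[x_i]\otimes[x_j]}=T_{[x_j]}\circ T_{[x_i]}$. *)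

theory Defs
  imports
    "HOL-Analysis.Finite_Cartesian_Product"
    "HOL-Library.Poly_Mapping"
begin

text \<open>
  Formal real polynomials in the variables indexed by the finite type \<open>'n\<close>: finitely supported
  maps from exponent vectors to coefficients, with the convolution product of
  \<open>HOL-Library.Poly_Mapping\<close>.  The number of variables is \<open>CARD('n)\<close>.
\<close>

type_synonym 'n real_mpoly = "('n \<Rightarrow>\<^sub>0 nat) \<Rightarrow>\<^sub>0 real"

type_synonym 'n tuple = "'n \<Rightarrow> 'n real_mpoly"

text \<open>
  Formal partial derivative, monomial by monomial: \<open>c x\<^sup>m\<close> goes to \<open>m\<^sub>i c x\<^bsup>m - e\<^sub>i\<^esup>\<close>.  If \<open>m\<^sub>i = 0\<close> the
  subtraction of exponents is truncated, but then the coefficient is \<open>0\<close>.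
\<close>

definition partial_deriv :: "'n \<Rightarrow> 'n real_mpoly \<Rightarrow> 'n real_mpoly" where
  "partial_deriv i f =
     (\<Sum>m\<in>Poly_Mapping.keys f.
        Poly_Mapping.single (m - Poly_Mapping.single i 1)
          (of_nat (Poly_Mapping.lookup m i) * Poly_Mapping.lookup f m))"

definition nabla :: "'n \<Rightarrow> 'n tuple \<Rightarrow> 'n tuple" where
  "nabla i S = (\<lambda>k. partial_deriv i (S k))"

definition gamma :: "'n::finite tuple \<Rightarrow> ('n real_mpoly)^'n" where
  "gamma S = (\<chi> k. S k)"

definition beta :: "('n real_mpoly)^'n::finite \<Rightarrow> ('n real_mpoly)^'n" where
  "beta v = (\<chi> r t. if r = t then 0 else 1) *v v"

definition expansion :: "'n::finite \<Rightarrow> 'n tuple \<Rightarrow> 'n tuple" where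
  "expansion i = inv gamma \<circ> beta \<circ> gamma \<circ> nabla i"

definition mixed_expansion :: "'n::finite \<Rightarrow> 'n \<Rightarrow> 'n tuple \<Rightarrow> 'n tuple" where
  "mixed_expansion i j = expansion j \<circ> expansion i"

end

theory Submission
  imports Defs
begin

text \<open>
  The expansion is a matrix with constant entries applied after a partial derivative.  Partial
  derivatives are additive, hence pass through the sums that the matrix forms
  (\<open>partial_deriv_sum\<close>), and so every entry of an iterated expansion is one and the same sum of
  second partial derivatives, whichever direction comes first.  What remains is the symmetry of
  formal second derivatives (\<open>partial_deriv_commute\<close>).

  Both facts about derivatives are read off from coefficients: the coefficient of \<open>x\<^sup>m\<close> in
  \<open>\<partial>f/\<partial>x\<^sub>i\<close> is \<open>m\<^sub>i + 1\<close> times that of \<open>x\<^bsup>m + e\<^sub>i\<^esup>\<close> in \<open>f\<close>.  This formula no longer refers to the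
  support of \<open>f\<close>, over which the derivative is defined as a sum.
\<close>

text \<open>
  Only exponents \<open>k\<close> with \<open>k - e\<^sub>i = m\<close> contribute to the coefficient of \<open>x\<^sup>m\<close>.  Truncated
  subtraction allows \<open>k = m\<close> besides \<open>k = m + e\<^sub>i\<close> if \<open>m\<^sub>i = 0\<close>, but this term carries the factor
  \<open>k\<^sub>i = 0\<close>.
\<close>

lemma lookup_partial_deriv:
  "Poly_Mapping.lookup (partial_deriv i f) m =
     of_nat (Poly_Mapping.lookup m i + 1) * Poly_Mapping.lookup f (m + Poly_Mapping.single i 1)"
proof -
  let ?e = "Poly_Mapping.single i (1::nat)"
  let ?c = "\<lambda>k. of_nat (Poly_Mapping.lookup k i) * Poly_Mapping.lookup f k"
  have unique: "k = m + ?e" if "k - ?e = m" "Poly_Mapping.lookup k i \<noteq> 0" for k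
  proof (rule poly_mapping_eqI)
    fix x
    have "Poly_Mapping.lookup k x - Poly_Mapping.lookup ?e x = Poly_Mapping.lookup m x"
      using that(1) by (auto simp: lookup_minus)
    then show "Poly_Mapping.lookup k x = Poly_Mapping.lookup (m + ?e) x"
      using that(2) by (cases "x = i") (auto simp: lookup_add lookup_single when_def)
  qed
  have "Poly_Mapping.lookup (partial_deriv i f) m =
      (\<Sum>k\<in>Poly_Mapping.keys f. ?c k when k - ?e = m)"
    by (simp add: partial_deriv_def lookup_sum lookup_single)
  also have "\<dots> = (\<Sum>k\<in>Poly_Mapping.keys f. if k = m + ?e then ?c k else 0)"
    using unique by (intro sum.cong refl) (auto simp: when_def)
  also have "\<dots> = ?c (m + ?e)"
    by (simp add: in_keys_iff)
  also have "\<dots> = of_nat (Poly_Mapping.lookup m i + 1) * Poly_Mapping.lookup f (m + ?e)"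
    by (simp add: lookup_add)
  finally show ?thesis .
qed

lemma partial_deriv_zero: "partial_deriv i 0 = 0"
  by (simp add: partial_deriv_def)

lemma partial_deriv_add: "partial_deriv i (f + g) = partial_deriv i f + partial_deriv i g"
  by (rule poly_mapping_eqI) (simp only: lookup_partial_deriv lookup_add distrib_left)

lemma partial_deriv_sum: "partial_deriv i (\<Sum>a\<in>A. f a) = (\<Sum>a\<in>A. partial_deriv i (f a))"
  by (induction A rule: infinite_finite_induct)
    (simp_all add: partial_deriv_zero partial_deriv_add)

text \<open>
  For distinct directions, both iterated derivatives multiply the coefficient of
  \<open>x\<^bsup>m + e\<^sub>i + e\<^sub>j\<^esup>\<close> by \<open>(m\<^sub>i + 1)(m\<^sub>j + 1)\<close>, because adding \<open>e\<^sub>i\<close> does not change the exponent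
  of \<open>x\<^sub>j\<close>.
\<close>

lemma partial_deriv_commute:
  "partial_deriv j (partial_deriv i f) = partial_deriv i (partial_deriv j f)"
proof (cases "i = j")
  case False
  then show ?thesis
    by (intro poly_mapping_eqI) (simp add: lookup_partial_deriv lookup_add lookup_single add_ac)
qed simp

lemma inv_gamma: "inv gamma v = vec_nth v"
  by (rule inv_f_eq) (auto simp: inj_def gamma_def vec_eq_iff fun_eq_iff)

lemma expansion_entry: "expansion i S r = (\<Sum>t\<in>UNIV - {r}. partial_deriv i (S t))"
proof -
  have "expansion i S r = (\<Sum>t\<in>UNIV. (if r = t then 0 else 1) * partial_deriv i (S t))"
    by (simp add: expansion_def inv_gamma beta_def gamma_def nabla_def matrix_vector_mult_def)
  also have "\<dots> = (\<Sum>t\<in>UNIV - {r}. partial_deriv i (S t))"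
    by (rule sum.mono_neutral_cong_right) auto
  finally show ?thesis .
qed

lemma mixed_expansion_entry:
  "mixed_expansion i j S r =
     (\<Sum>t\<in>UNIV - {r}. \<Sum>s\<in>UNIV - {t}. partial_deriv j (partial_deriv i (S s)))"
  by (simp add: mixed_expansion_def expansion_entry partial_deriv_sum)

theorem proposition2p3:
  fixes S :: "'n::finite tuple" and i j :: 'n
  assumes "CARD('n) \<ge> 2"
  shows "mixed_expansion i j S = mixed_expansion j i S"
  by (rule ext) (simp only: mixed_expansion_entry partial_deriv_commute[of j i])

end
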